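(* Let $\mathcal{M}$ be a II$_1$ factor and let $\mathcal{A}\subseteq\mathcal{M}$ be a totally complementable masa. Then for every discrete operator $a\in\mathcal{A}$ with $0\le a\le 1$ there exists a projection $p\in\mathcal{M}$ such that $E_{\mathcal{A}}(p)=a$.
   Context: $\mathcal{M}$ is a II$_1$ factor with normalized faithful normal trace $\tau$. A masa is a maximal abelian self-adjoint (von Neumann) subalgebra. For a von Neumann subalgebra $\mathcal{A}\subseteq\mathcal{M}$, $E_{\mathcal{A}}:\mathcal{M}\to\mathcal{A}$ denotes the unique trace-preserving conditional expectation onto $\mathcal{A}$. Projections are self-adjoint idempotents. Two von Neumann subalgebras $\mathcal{A},\mathcal{B}$ of a II$_1$ factor $\mathcal{N}$ are called orthogonal in $\mathcal{N}$ if $E_{\mathcal{A}}(\mathcal{B})\subseteq\mathbb{C}\,I$, where $I$ is the identity of $\mathcal{N}$. A masa $\mathcal{A}\subset\mathcal{M}$ is called totally complementable if for every (nonzero) projection $p\in\mathcal{A}$, the masa $p\mathcal{A}$ of the II$_1$ factor $p\mathcal{M}p$ (whose identity is $p$) admits a diffuse orthogonal subalgebra, i.e. there is a diffuse von Neumann subalgebra $\mathcal{B}_p\subseteq p\mathcal{M}p$ (one with no minimal projections), with unit $p$, such that $E_{p\mathcal{A}}(\mathcal{B}_p)\subseteq\mathbb{C}\,p$. An operator $a\in\mathcal{A}$ is discrete if $a=\sum_k\alpha_k p_k$ for a (finite or infinite) sequence $\{p_k\}$ of mutually orthogonal projections in $\mathcal{A}$ and scalars $\alpha_k$. *)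

theory Defs
  imports "HOL-Analysis.Analysis"
begin

text \<open>Complex Hilbert spaces; the inner product is conjugate-linear in its first argument.\<close>

class chilbert_space = banach +
  fixes scaleC :: "complex \<Rightarrow> 'a \<Rightarrow> 'a"
    and cinner :: "'a \<Rightarrow> 'a \<Rightarrow> complex"
  assumes scaleC_of_real: "scaleC (complex_of_real r) x = r *\<^sub>R x"
    and scaleC_add_right: "scaleC c (x + y) = scaleC c x + scaleC c y"
    and scaleC_add_left: "scaleC (c + d) x = scaleC c x + scaleC d x"
    and scaleC_scaleC: "scaleC c (scaleC d x) = scaleC (c * d) x"
    and cinner_commute: "cinner x y = cnj (cinner y x)"
    and cinner_add_right: "cinner x (y + z) = cinner x y + cinner x z"
    and cinner_scaleC_right: "cinner x (scaleC c y) = c * cinner x y"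
    and cinner_self: "cinner x x = complex_of_real ((norm x)\<^sup>2)"

lemma norm_scaleC: "norm (scaleC c x) = cmod c * norm (x :: 'a :: chilbert_space)"
proof -
  have "complex_of_real ((norm (scaleC c x))\<^sup>2) = c * cinner (scaleC c x) x"
    by (metis cinner_self cinner_scaleC_right)
  also have "cinner (scaleC c x) x = cnj c * cinner x x"
    by (metis cinner_commute cinner_scaleC_right complex_cnj_mult)
  also have "c * (cnj c * cinner x x) = complex_of_real ((cmod c * norm x)\<^sup>2)"
    using complex_norm_square[of c]
    by (simp add: cinner_self power_mult_distrib mult.assoc[symmetric])
  finally have "(norm (scaleC c x))\<^sup>2 = (cmod c * norm x)\<^sup>2"
    using of_real_eq_iff by blast
  then show ?thesis
    by (simp add: power2_eq_iff_nonneg)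
qed

lemma bounded_linear_scaleC: "bounded_linear (scaleC c :: 'a :: chilbert_space \<Rightarrow> 'a)"
proof (rule bounded_linear_intro[where K = "cmod c"])
  fix x y :: 'a and r :: real
  show "scaleC c (x + y) = scaleC c x + scaleC c y"
    by (rule scaleC_add_right)
  show "scaleC c (r *\<^sub>R x) = r *\<^sub>R scaleC c x"
    by (metis scaleC_of_real scaleC_scaleC mult.commute)
  show "norm (scaleC c x) \<le> norm x * cmod c"
    by (simp add: norm_scaleC mult.commute)
qed

text \<open>
  The type \<open>'h \<Rightarrow>\<^sub>L 'h\<close> consists of the bounded real-linear operators; the algebra of
  bounded complex-linear operators is carved out of it by \<open>bounded_ops\<close>.
\<close>

definition bounded_ops :: "('h::chilbert_space \<Rightarrow>\<^sub>L 'h) set" where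
  "bounded_ops = {T. \<forall>c x. blinfun_apply T (scaleC c x) = scaleC c (blinfun_apply T x)}"

lift_definition scaleC_op :: "complex \<Rightarrow> ('h::chilbert_space \<Rightarrow>\<^sub>L 'h) \<Rightarrow> 'h \<Rightarrow>\<^sub>L 'h"
  is "\<lambda>c T x. scaleC c (T x)"
  by (rule bounded_linear_compose[OF bounded_linear_scaleC])

definition is_adjoint :: "('h::chilbert_space \<Rightarrow>\<^sub>L 'h) \<Rightarrow> ('h \<Rightarrow>\<^sub>L 'h) \<Rightarrow> bool" where
  "is_adjoint T S \<longleftrightarrow> (\<forall>x y. cinner (S x) y = cinner x (T y))"

definition positive_op :: "('h::chilbert_space \<Rightarrow>\<^sub>L 'h) \<Rightarrow> bool" where
  "positive_op T \<longleftrightarrow> (\<forall>x. cinner x (T x) \<in> \<real> \<and> 0 \<le> Re (cinner x (T x)))"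

definition op_le :: "('h::chilbert_space \<Rightarrow>\<^sub>L 'h) \<Rightarrow> ('h \<Rightarrow>\<^sub>L 'h) \<Rightarrow> bool" where
  "op_le S T \<longleftrightarrow> positive_op (T - S)"

definition projection :: "('h::chilbert_space \<Rightarrow>\<^sub>L 'h) \<Rightarrow> bool" where
  "projection p \<longleftrightarrow> p \<in> bounded_ops \<and> is_adjoint p p \<and> p o\<^sub>L p = p"

definition wot_closed :: "('h::chilbert_space \<Rightarrow>\<^sub>L 'h) set \<Rightarrow> bool" where
  "wot_closed N \<longleftrightarrow>
     (\<forall>T\<in>bounded_ops. \<forall>F. F \<noteq> bot \<and> (\<forall>\<^sub>F S in F. S \<in> N) \<and>
        (\<forall>x y. ((\<lambda>S. cinner y (blinfun_apply S x)) \<longlongrightarrow> cinner y (blinfun_apply T x)) F) \<longrightarrow> T \<in> N)"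

text \<open>
  The unit \<open>e\<close> is not required to be the identity of the whole space, so that a corner of a
  von Neumann algebra is again covered. An algebra with unit \<open>e\<close> vanishes on the orthogonal
  complement of the range of \<open>e\<close>, hence is closed as a set of operators on the whole space iff
  it is closed as a set of operators on the range of \<open>e\<close>.
\<close>

definition von_neumann_algebra :: "('h::chilbert_space \<Rightarrow>\<^sub>L 'h) set \<Rightarrow> ('h \<Rightarrow>\<^sub>L 'h) \<Rightarrow> bool" where
  "von_neumann_algebra N e \<longleftrightarrow>
     N \<subseteq> bounded_ops \<and>
     (\<forall>S\<in>N. \<forall>T\<in>N. S + T \<in> N) \<and>
     (\<forall>c. \<forall>T\<in>N. scaleC_op c T \<in> N) \<and>
     (\<forall>S\<in>N. \<forall>T\<in>N. S o\<^sub>L T \<in> N) \<and>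
     (\<forall>T\<in>N. \<exists>S\<in>N. is_adjoint T S) \<and>
     e \<in> N \<and> (\<forall>T\<in>N. e o\<^sub>L T = T \<and> T o\<^sub>L e = T) \<and>
     wot_closed N"

definition minimal_projection :: "('h::chilbert_space \<Rightarrow>\<^sub>L 'h) set \<Rightarrow> ('h \<Rightarrow>\<^sub>L 'h) \<Rightarrow> bool" where
  "minimal_projection N q \<longleftrightarrow>
     q \<in> N \<and> projection q \<and> q \<noteq> 0 \<and>
     (\<forall>r\<in>N. projection r \<and> op_le r q \<longrightarrow> r = 0 \<or> r = q)"

definition diffuse :: "('h::chilbert_space \<Rightarrow>\<^sub>L 'h) set \<Rightarrow> bool" where
  "diffuse N \<longleftrightarrow> (\<nexists>q. minimal_projection N q)"

definition factor :: "('h::chilbert_space \<Rightarrow>\<^sub>L 'h) set \<Rightarrow> ('h \<Rightarrow>\<^sub>L 'h) \<Rightarrow> bool" where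
  "factor N e \<longleftrightarrow> von_neumann_algebra N e \<and> e \<noteq> 0 \<and>
     (\<forall>T\<in>N. (\<forall>S\<in>N. T o\<^sub>L S = S o\<^sub>L T) \<longrightarrow> (\<exists>c. T = scaleC_op c e))"

definition finite_vna :: "('h::chilbert_space \<Rightarrow>\<^sub>L 'h) set \<Rightarrow> ('h \<Rightarrow>\<^sub>L 'h) \<Rightarrow> bool" where
  "finite_vna N e \<longleftrightarrow>
     (\<forall>v\<in>N. \<forall>w\<in>N. is_adjoint v w \<and> w o\<^sub>L v = e \<longrightarrow> v o\<^sub>L w = e)"

text \<open>In a finite factor, being of type II amounts to having no minimal projections.\<close>

definition II1_factor :: "('h::chilbert_space \<Rightarrow>\<^sub>L 'h) set \<Rightarrow> ('h \<Rightarrow>\<^sub>L 'h) \<Rightarrow> bool" where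
  "II1_factor N e \<longleftrightarrow> factor N e \<and> finite_vna N e \<and> diffuse N"

definition clinear_functional ::
    "('h::chilbert_space \<Rightarrow>\<^sub>L 'h) set \<Rightarrow> (('h \<Rightarrow>\<^sub>L 'h) \<Rightarrow> complex) \<Rightarrow> bool" where
  "clinear_functional N \<phi> \<longleftrightarrow>
     (\<forall>S\<in>N. \<forall>T\<in>N. \<phi> (S + T) = \<phi> S + \<phi> T) \<and> (\<forall>c. \<forall>T\<in>N. \<phi> (scaleC_op c T) = c * \<phi> T)"

definition positive_functional ::
    "('h::chilbert_space \<Rightarrow>\<^sub>L 'h) set \<Rightarrow> (('h \<Rightarrow>\<^sub>L 'h) \<Rightarrow> complex) \<Rightarrow> bool" where
  "positive_functional N \<phi> \<longleftrightarrow> (\<forall>T\<in>N. positive_op T \<longrightarrow> \<phi> T \<in> \<real> \<and> 0 \<le> Re (\<phi> T))"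

definition supremum_in ::
    "('h::chilbert_space \<Rightarrow>\<^sub>L 'h) set \<Rightarrow> ('h \<Rightarrow>\<^sub>L 'h) set \<Rightarrow> ('h \<Rightarrow>\<^sub>L 'h) \<Rightarrow> bool" where
  "supremum_in N D T \<longleftrightarrow>
     T \<in> N \<and> (\<forall>S\<in>D. op_le S T) \<and> (\<forall>U\<in>N. (\<forall>S\<in>D. op_le S U) \<longrightarrow> op_le T U)"

text \<open>Normality: suprema of (bounded) upward directed sets of positive elements are preserved.\<close>

definition normal_functional ::
    "('h::chilbert_space \<Rightarrow>\<^sub>L 'h) set \<Rightarrow> (('h \<Rightarrow>\<^sub>L 'h) \<Rightarrow> complex) \<Rightarrow> bool" where
  "normal_functional N \<phi> \<longleftrightarrow>
     (\<forall>D T. D \<subseteq> N \<and> D \<noteq> {} \<and> (\<forall>S\<in>D. positive_op S) \<and>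
        (\<forall>S\<in>D. \<forall>S'\<in>D. \<exists>U\<in>D. op_le S U \<and> op_le S' U) \<and> supremum_in N D T \<longrightarrow>
        Re (\<phi> T) = (SUP S\<in>D. Re (\<phi> S)))"

definition normalized_faithful_normal_trace ::
    "('h::chilbert_space \<Rightarrow>\<^sub>L 'h) set \<Rightarrow> ('h \<Rightarrow>\<^sub>L 'h) \<Rightarrow> (('h \<Rightarrow>\<^sub>L 'h) \<Rightarrow> complex) \<Rightarrow> bool" where
  "normalized_faithful_normal_trace N e \<tau> \<longleftrightarrow>
     clinear_functional N \<tau> \<and> positive_functional N \<tau> \<and> normal_functional N \<tau> \<and>
     (\<forall>S\<in>N. \<forall>T\<in>N. \<tau> (S o\<^sub>L T) = \<tau> (T o\<^sub>L S)) \<and>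
     (\<forall>T\<in>N. positive_op T \<and> \<tau> T = 0 \<longrightarrow> T = 0) \<and>
     \<tau> e = 1"

definition abelian :: "('h::chilbert_space \<Rightarrow>\<^sub>L 'h) set \<Rightarrow> bool" where
  "abelian N \<longleftrightarrow> (\<forall>S\<in>N. \<forall>T\<in>N. S o\<^sub>L T = T o\<^sub>L S)"

definition masa ::
    "('h::chilbert_space \<Rightarrow>\<^sub>L 'h) set \<Rightarrow> ('h \<Rightarrow>\<^sub>L 'h) \<Rightarrow> ('h \<Rightarrow>\<^sub>L 'h) set \<Rightarrow> bool" where
  "masa N e A \<longleftrightarrow>
     A \<subseteq> N \<and> von_neumann_algebra A e \<and> abelian A \<and>
     (\<forall>B. A \<subseteq> B \<and> B \<subseteq> N \<and> von_neumann_algebra B e \<and> abelian B \<longrightarrow> B = A)"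

text \<open>
  \<open>E\<close> is the \<open>\<tau>\<close>-preserving conditional expectation of \<open>N\<close> onto \<open>A\<close>. For a faithful normal
  trace \<open>\<tau>\<close> such an \<open>E\<close> exists and its values on \<open>N\<close> are uniquely determined; its values
  outside \<open>N\<close> are irrelevant. Rescaling \<open>\<tau>\<close> does not change the condition, so on a corner
  \<open>pNp\<close> the trace \<open>\<tau>\<close> of \<open>N\<close> may be used in place of the normalized trace \<open>\<tau> / \<tau>(p)\<close>.
\<close>

definition conditional_expectation ::
    "('h::chilbert_space \<Rightarrow>\<^sub>L 'h) set \<Rightarrow> (('h \<Rightarrow>\<^sub>L 'h) \<Rightarrow> complex) \<Rightarrow> ('h \<Rightarrow>\<^sub>L 'h) set \<Rightarrow>
     (('h \<Rightarrow>\<^sub>L 'h) \<Rightarrow> ('h \<Rightarrow>\<^sub>L 'h)) \<Rightarrow> bool" where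
  "conditional_expectation N \<tau> A E \<longleftrightarrow>
     (\<forall>x\<in>N. E x \<in> A) \<and>
     (\<forall>x\<in>N. \<forall>y\<in>N. E (x + y) = E x + E y) \<and>
     (\<forall>c. \<forall>x\<in>N. E (scaleC_op c x) = scaleC_op c (E x)) \<and>
     (\<forall>x\<in>N. positive_op x \<longrightarrow> positive_op (E x)) \<and>
     (\<forall>a\<in>A. E a = a) \<and>
     (\<forall>a\<in>A. \<forall>x\<in>N. \<forall>b\<in>A. E (a o\<^sub>L x o\<^sub>L b) = a o\<^sub>L E x o\<^sub>L b) \<and>
     (\<forall>x\<in>N. \<tau> (E x) = \<tau> x)"

definition orthogonal_subalgebras ::
    "('h::chilbert_space \<Rightarrow>\<^sub>L 'h) set \<Rightarrow> ('h \<Rightarrow>\<^sub>L 'h) \<Rightarrow> (('h \<Rightarrow>\<^sub>L 'h) \<Rightarrow> complex) \<Rightarrow>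
     ('h \<Rightarrow>\<^sub>L 'h) set \<Rightarrow> ('h \<Rightarrow>\<^sub>L 'h) set \<Rightarrow> bool" where
  "orthogonal_subalgebras N e \<tau> A B \<longleftrightarrow>
     (\<exists>E. conditional_expectation N \<tau> A E \<and> E ` B \<subseteq> range (\<lambda>c. scaleC_op c e))"

definition corner :: "('h::chilbert_space \<Rightarrow>\<^sub>L 'h) set \<Rightarrow> ('h \<Rightarrow>\<^sub>L 'h) \<Rightarrow> ('h \<Rightarrow>\<^sub>L 'h) set" where
  "corner N p = (\<lambda>x. p o\<^sub>L x o\<^sub>L p) ` N"

definition totally_complementable ::
    "('h::chilbert_space \<Rightarrow>\<^sub>L 'h) set \<Rightarrow> (('h \<Rightarrow>\<^sub>L 'h) \<Rightarrow> complex) \<Rightarrow> ('h \<Rightarrow>\<^sub>L 'h) set \<Rightarrow> bool" where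
  "totally_complementable M \<tau> A \<longleftrightarrow>
     (\<forall>p\<in>A. projection p \<and> p \<noteq> 0 \<longrightarrow>
        (\<exists>B. von_neumann_algebra B p \<and> B \<subseteq> corner M p \<and> diffuse B \<and>
             orthogonal_subalgebras (corner M p) p \<tau> ((\<lambda>a. p o\<^sub>L a) ` A) B))"

text \<open>
  \<open>a = \<Sum>k. \<alpha> k p k\<close> with convergence in the strong operator topology. The projections may
  vanish, so finite sequences are included.
\<close>

definition discrete_op :: "('h::chilbert_space \<Rightarrow>\<^sub>L 'h) set \<Rightarrow> ('h \<Rightarrow>\<^sub>L 'h) \<Rightarrow> bool" where
  "discrete_op A a \<longleftrightarrow>
     a \<in> A \<and>
     (\<exists>(\<alpha> :: nat \<Rightarrow> complex) (p :: nat \<Rightarrow> 'h \<Rightarrow>\<^sub>L 'h).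
        (\<forall>k. p k \<in> A \<and> projection (p k)) \<and>
        (\<forall>j k. j \<noteq> k \<longrightarrow> p j o\<^sub>L p k = 0) \<and>
        (\<forall>x. (\<lambda>k. scaleC (\<alpha> k) (blinfun_apply (p k) x)) sums blinfun_apply a x))"

end

theory Submission
  imports Defs
begin

text \<open>
  Let \<open>a = \<Sum>k. \<alpha> k p k\<close> with \<open>0 \<le> \<alpha> k \<le> 1\<close>. It suffices to find, for each \<open>k\<close> separately, a
  projection \<open>q k\<close> below \<open>p k\<close> whose expectation is \<open>\<alpha> k p k\<close>: such \<open>q k\<close> are mutually
  orthogonal, and their strong sum \<open>Q\<close> satisfies \<open>E(Q) p k = E(Q p k) = E(q k) = a p k\<close> for all
  \<open>k\<close>. As \<open>Q = Q P\<close> for \<open>P = \<Sum>k. p k \<in> A\<close>, summing over \<open>k\<close> gives \<open>E(Q) = E(Q) P = a\<close>. The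
  module property of \<open>E\<close> thus reduces the infinite sum to its single terms.

  Now fix \<open>p = p k \<noteq> 0\<close> and \<open>t = \<alpha> k\<close>. Total complementability provides a diffuse algebra \<open>B\<close>
  with unit \<open>p\<close> that the expectation onto \<open>p A\<close> maps to the scalar multiples of \<open>p\<close>. Since this
  expectation preserves the trace, it maps every projection \<open>q \<in> B\<close> with \<open>\<tau> q = t \<tau> p\<close> to
  \<open>t p\<close>, and so does \<open>E\<close>, because an expectation is characterized by the trace pairing with
  \<open>A\<close> (\<open>projection_expectation_scalar\<close>).

  That leaves the existence of such a \<open>q\<close> (\<open>diffuse_prescribed_trace\<close>). Halving repeatedly, a
  diffuse algebra has nonzero projections of arbitrarily small trace below any nonzero
  projection; a greedy exhaustion combined with normality of the trace then attains every value
  between \<open>0\<close> and \<open>\<tau> p\<close>. Both this argument and the sum \<open>Q\<close> rest on the fact that an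
  increasing sequence of projections converges strongly to a projection in the algebra
  (\<open>increasing_projections_converge\<close>, \<open>vna_strong_limit\<close>).
\<close>

section \<open>Inner products and projections\<close>

lemma cinner_add_left: "cinner (x + y) z = cinner x z + cinner y (z::'a::chilbert_space)"
  by (metis cinner_add_right cinner_commute complex_cnj_add)

lemma scaleC_minus_one: "scaleC (-1) x = - (x::'a::chilbert_space)"
  using scaleC_of_real[of "-1" x] by simp

lemma cinner_minus_right: "cinner x (- y) = - cinner x (y::'a::chilbert_space)"
  by (metis cinner_scaleC_right mult_minus1 scaleC_minus_one)

lemma cinner_diff_right: "cinner x (y - z) = cinner x y - cinner x (z::'a::chilbert_space)"
  using cinner_add_right[of x y "- z"] by (simp add: cinner_minus_right)

lemma cinner_diff_left: "cinner (x - y) z = cinner x z - cinner y (z::'a::chilbert_space)"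
  by (metis cinner_commute cinner_diff_right complex_cnj_diff)

lemma cinner_zero_right: "cinner x (0::'a::chilbert_space) = 0"
  using cinner_diff_right[of x 0 0] by simp

lemma cinner_left_eqI:
  assumes "\<And>y. cinner y u = cinner y (v::'a::chilbert_space)"
  shows "u = v"
proof -
  have "cinner (u - v) (u - v) = 0"
    using assms by (simp add: cinner_diff_right)
  then show ?thesis by (simp add: cinner_self)
qed

lemma Re_cinner_polarization:
  "Re (cinner y x) = ((norm (x + y))\<^sup>2 - (norm x)\<^sup>2 - (norm y)\<^sup>2) / 2"
  for x y :: "'a::chilbert_space"
proof -
  have "complex_of_real ((norm (x + y))\<^sup>2)
      = cinner x x + cinner y y + (cinner y x + cnj (cinner y x))"
    unfolding cinner_self[symmetric]
    by (simp add: cinner_add_left cinner_add_right cinner_commute[of x y])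
  then have "(norm (x + y))\<^sup>2 = (norm x)\<^sup>2 + (norm y)\<^sup>2 + 2 * Re (cinner y x)"
    by (auto simp: cinner_self complex_eq_iff)
  then show ?thesis by simp
qed

text \<open>Polarization expresses the inner product through norms, which are continuous.\<close>

lemma tendsto_cinner_right:
  fixes f :: "'b \<Rightarrow> 'a::chilbert_space"
  assumes "(f \<longlongrightarrow> l) F"
  shows "((\<lambda>n. cinner y (f n)) \<longlongrightarrow> cinner y l) F"
proof -
  have Re: "((\<lambda>n. Re (cinner y (g n))) \<longlongrightarrow> Re (cinner y m)) F"
    if "(g \<longlongrightarrow> m) F" for g m
    unfolding Re_cinner_polarization by (intro tendsto_intros that) auto
  have "((\<lambda>n. scaleC (-\<i>) (f n)) \<longlongrightarrow> scaleC (-\<i>) l) F"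
    by (rule bounded_linear.tendsto[OF bounded_linear_scaleC assms])
  from Re[OF this] have "((\<lambda>n. Im (cinner y (f n))) \<longlongrightarrow> Im (cinner y l)) F"
    by (simp add: cinner_scaleC_right)
  with Re[OF assms] show ?thesis by (simp add: tendsto_complex_iff)
qed

lemma tendsto_cinner_left:
  fixes f :: "'b \<Rightarrow> 'a::chilbert_space"
  assumes "(f \<longlongrightarrow> l) F"
  shows "((\<lambda>n. cinner (f n) y) \<longlongrightarrow> cinner l y) F"
  using tendsto_cnj[OF tendsto_cinner_right[OF assms, of y]] by (simp add: cinner_commute[symmetric])

lemma projection_scaleC: "projection p \<Longrightarrow> blinfun_apply p (scaleC c x) = scaleC c (p x)"
  by (simp add: projection_def bounded_ops_def)

lemma projection_cinner: "projection p \<Longrightarrow> cinner (blinfun_apply p x) y = cinner x (p y)"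
  by (simp add: projection_def is_adjoint_def)

lemma projection_idem: "projection p \<Longrightarrow> blinfun_apply p (p x) = p x"
  by (metis blinfun_apply_blinfun_compose projection_def)

lemma projectionI:
  fixes p :: "'h::chilbert_space \<Rightarrow>\<^sub>L 'h"
  assumes "\<And>c x. p (scaleC c x) = scaleC c (p x)"
    and "\<And>x y. cinner (p x) y = cinner x (p y)"
    and "\<And>x. p (p x) = p x"
  shows "projection p"
  using assms by (auto simp: projection_def bounded_ops_def is_adjoint_def intro: blinfun_eqI)

lemma cinner_projection_self:
  fixes p :: "'h::chilbert_space \<Rightarrow>\<^sub>L 'h"
  assumes "projection p"
  shows "cinner x (p x) = complex_of_real ((norm (p x))\<^sup>2)"
  using projection_cinner[OF assms, of x "p x"] projection_idem[OF assms, of x]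
  by (simp add: cinner_self)

lemma positive_projection: "projection p \<Longrightarrow> positive_op p"
  by (simp add: positive_op_def cinner_projection_self)

lemma scaleC_zero_right: "scaleC c (0::'a::chilbert_space) = 0"
  using norm_scaleC[of c "0::'a"] by simp

lemma cinner_zero_left: "cinner (0::'a::chilbert_space) x = 0"
  by (metis cinner_commute cinner_zero_right complex_cnj_zero)

lemma projection_zero: "projection 0"
  by (rule projectionI) (simp_all add: cinner_zero_right cinner_zero_left scaleC_zero_right)

text \<open>Taking adjoints reverses a product of projections.\<close>

lemma projection_compose_commute:
  fixes q r c :: "'h::chilbert_space \<Rightarrow>\<^sub>L 'h"
  assumes "projection q" "projection r" "projection c" "q o\<^sub>L r = c"
  shows "r o\<^sub>L q = c"
proof (rule blinfun_eqI, rule cinner_left_eqI)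
  fix x y
  have "q (r y) = c y" by (simp flip: assms(4))
  then have "cinner (q (r y)) x = cinner y (c x)"
    using projection_cinner[OF assms(3), of y x] by simp
  then show "cinner y ((r o\<^sub>L q) x) = cinner y (c x)"
    using projection_cinner[OF assms(1), of "r y" x] projection_cinner[OF assms(2), of y "q x"]
    by simp
qed

lemma projection_absorb_commute:
  fixes q r :: "'h::chilbert_space \<Rightarrow>\<^sub>L 'h"
  shows "projection q \<Longrightarrow> projection r \<Longrightarrow> q o\<^sub>L r = r \<Longrightarrow> r o\<^sub>L q = r"
  by (rule projection_compose_commute)

lemmas projection_orthogonal_commute = projection_compose_commute[OF _ _ projection_zero]

lemma projection_diff:
  assumes "projection q" "projection r" "q o\<^sub>L r = r"
  shows "projection (q - r)"
proof (rule projectionI)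
  have qr: "q (r x) = r x" for x using assms(3) by (metis blinfun_apply_blinfun_compose)
  have rq: "r (q x) = r x" for x
    using projection_absorb_commute[OF assms] by (metis blinfun_apply_blinfun_compose)
  show "(q - r) ((q - r) x) = (q - r) x" for x
    by (simp add: blinfun.diff_left blinfun.diff_right qr rq
        projection_idem[OF assms(1)] projection_idem[OF assms(2)])
  show "cinner ((q - r) x) y = cinner x ((q - r) y)" for x y
    by (simp add: blinfun.diff_left cinner_diff_left cinner_diff_right
        projection_cinner[OF assms(1)] projection_cinner[OF assms(2)])
  show "(q - r) (scaleC c x) = scaleC c ((q - r) x)" for c x
    by (simp add: blinfun.diff_left projection_scaleC[OF assms(1)] projection_scaleC[OF assms(2)]
        linear_diff[OF bounded_linear.linear[OF bounded_linear_scaleC]])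
qed

lemma projection_add:
  assumes "projection q" "projection r" "q o\<^sub>L r = 0"
  shows "projection (q + r)"
proof (rule projectionI)
  have qr: "q (r x) = 0" for x
    using assms(3) by (metis blinfun_apply_blinfun_compose zero_blinfun.rep_eq)
  have rq: "r (q x) = 0" for x
    using projection_orthogonal_commute[OF assms]
    by (metis blinfun_apply_blinfun_compose zero_blinfun.rep_eq)
  show "(q + r) ((q + r) x) = (q + r) x" for x
    by (simp add: blinfun.add_left blinfun.add_right qr rq
        projection_idem[OF assms(1)] projection_idem[OF assms(2)])
  show "cinner ((q + r) x) y = cinner x ((q + r) y)" for x y
    by (simp add: blinfun.add_left cinner_add_left cinner_add_right
        projection_cinner[OF assms(1)] projection_cinner[OF assms(2)])
  show "(q + r) (scaleC c x) = scaleC c ((q + r) x)" for c x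
    by (simp add: blinfun.add_left projection_scaleC[OF assms(1)] projection_scaleC[OF assms(2)]
        scaleC_add_right)
qed

text \<open>
  Domination \<open>r \<le> q\<close> forces \<open>\<parallel>r x\<parallel> \<le> \<parallel>q x\<parallel>\<close>, so \<open>r\<close> kills the kernel of \<open>q\<close>,
  in particular every \<open>x - q x\<close>.
\<close>

lemma op_le_projection_absorb:
  assumes "projection q" "projection r" "op_le r q"
  shows "q o\<^sub>L r = r"
proof -
  have le: "norm (r x) \<le> norm (q x)" for x
  proof -
    have "cinner x ((q - r) x) = complex_of_real ((norm (q x))\<^sup>2 - (norm (r x))\<^sup>2)"
      by (simp add: blinfun.diff_left cinner_diff_right cinner_projection_self assms(1,2))
    then have "(norm (r x))\<^sup>2 \<le> (norm (q x))\<^sup>2"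
      using assms(3) unfolding op_le_def positive_op_def by (metis Re_complex_of_real diff_ge_0_iff_ge)
    then show ?thesis by (simp add: power2_le_iff_abs_le)
  qed
  have "r o\<^sub>L q = r"
  proof (rule blinfun_eqI)
    fix x
    have "r (x - q x) = 0"
      using le[of "x - q x"] by (simp add: blinfun.diff_right projection_idem[OF assms(1)])
    then show "(r o\<^sub>L q) x = r x" by (simp add: blinfun.diff_right)
  qed
  show ?thesis
    by (rule projection_compose_commute[OF assms(2,1,2)]) fact
qed


section \<open>Limits of projections in a von Neumann algebra\<close>

lemma scaleC_op_apply: "blinfun_apply (scaleC_op c T) x = scaleC c (T x)"
  by (simp add: scaleC_op.rep_eq)

context
  fixes N :: "('h::chilbert_space \<Rightarrow>\<^sub>L 'h) set" and e
  assumes N: "von_neumann_algebra N e"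
begin

lemma vna_add: "S \<in> N \<Longrightarrow> T \<in> N \<Longrightarrow> S + T \<in> N"
  and vna_scaleC: "T \<in> N \<Longrightarrow> scaleC_op c T \<in> N"
  and vna_compose: "S \<in> N \<Longrightarrow> T \<in> N \<Longrightarrow> S o\<^sub>L T \<in> N"
  and vna_adjoint: "T \<in> N \<Longrightarrow> \<exists>S\<in>N. is_adjoint T S"
  and vna_unit: "e \<in> N"
  and vna_unit_left: "T \<in> N \<Longrightarrow> e o\<^sub>L T = T"
  using N unfolding von_neumann_algebra_def by auto

lemma vna_diff:
  assumes "S \<in> N" "T \<in> N"
  shows "S - T \<in> N"
proof -
  have "S - T = S + scaleC_op (-1) T"
    by (rule blinfun_eqI)
      (simp add: scaleC_op_apply scaleC_minus_one blinfun.diff_left blinfun.add_left)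
  then show ?thesis using vna_add[OF assms(1) vna_scaleC[OF assms(2), of "-1"]] by metis
qed

lemma vna_zero: "0 \<in> N"
  using vna_diff[OF vna_unit vna_unit] by simp

lemma vna_sum: "(\<And>k. k \<in> I \<Longrightarrow> f k \<in> N) \<Longrightarrow> sum f I \<in> N"
  by (induction I rule: infinite_finite_induct) (auto intro: vna_zero vna_add)

lemma vna_strong_limit:
  fixes s :: "nat \<Rightarrow> 'h \<Rightarrow>\<^sub>L 'h"
  assumes "T \<in> bounded_ops" "\<And>n. s n \<in> N" "\<And>x. (\<lambda>n. s n x) \<longlonglongrightarrow> T x"
  shows "T \<in> N"
proof -
  have "((\<lambda>S. cinner y (blinfun_apply S x)) \<longlongrightarrow> cinner y (blinfun_apply T x))
      (filtermap s sequentially)" for x y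
    using tendsto_cinner_right[OF assms(3)] by (simp add: filterlim_filtermap)
  moreover have "\<forall>\<^sub>F S in filtermap s sequentially. S \<in> N"
    using assms(2) by (simp add: eventually_filtermap)
  moreover have "filtermap s sequentially \<noteq> bot"
    by (simp add: filtermap_bot_iff)
  ultimately show ?thesis
    using N assms(1) unfolding von_neumann_algebra_def wot_closed_def by blast
qed

end

lemma norm_projection_le:
  fixes p :: "'h::chilbert_space \<Rightarrow>\<^sub>L 'h"
  assumes "projection p"
  shows "norm (p x) \<le> norm x"
proof -
  have "complex_of_real ((norm (x - p x))\<^sup>2) = cinner (x - p x) (x - p x)"
    by (simp add: cinner_self)
  also have "\<dots> = cinner x x - cinner x (p x)"
    by (simp add: cinner_diff_left cinner_diff_right projection_cinner[OF assms] projection_idem[OF assms])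
  also have "\<dots> = complex_of_real ((norm x)\<^sup>2 - (norm (p x))\<^sup>2)"
    by (simp add: cinner_projection_self[OF assms] cinner_self)
  finally have "complex_of_real ((norm (x - p x))\<^sup>2) = complex_of_real ((norm x)\<^sup>2 - (norm (p x))\<^sup>2)" .
  then have "0 \<le> (norm x)\<^sup>2 - (norm (p x))\<^sup>2"
    unfolding of_real_eq_iff by (metis zero_le_power2)
  then show ?thesis by (simp add: power2_le_iff_abs_le)
qed

text \<open>
  For \<open>m \<le> n\<close> the difference \<open>s n - s m\<close> is a projection, so that
  \<open>\<parallel>s n x - s m x\<parallel>\<^sup>2 = \<parallel>s n x\<parallel>\<^sup>2 - \<parallel>s m x\<parallel>\<^sup>2\<close>. The numbers \<open>\<parallel>s n x\<parallel>\<^sup>2\<close> increase and are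
  bounded by \<open>\<parallel>x\<parallel>\<^sup>2\<close>, so \<open>s n x\<close> is a Cauchy sequence.
\<close>

lemma increasing_projections_converge:
  fixes s :: "nat \<Rightarrow> 'h::chilbert_space \<Rightarrow>\<^sub>L 'h"
  assumes proj: "\<And>n. projection (s n)" and mono: "\<And>m n. m \<le> n \<Longrightarrow> s n o\<^sub>L s m = s m"
  obtains P where "projection P" "\<And>x. (\<lambda>n. s n x) \<longlonglongrightarrow> P x"
proof -
  have conv: "convergent (\<lambda>n. s n x)" for x
  proof -
    define f where "f n = (norm (s n x))\<^sup>2" for n
    have diff: "(norm (s n x - s m x))\<^sup>2 = f n - f m" if "m \<le> n" for m n
    proof -
      have "projection (s n - s m)" by (intro projection_diff proj mono that)
      then have "complex_of_real ((norm (s n x - s m x))\<^sup>2) = cinner x ((s n - s m) x)"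
        using cinner_projection_self[of "s n - s m" x] by (simp add: blinfun.diff_left)
      also have "\<dots> = complex_of_real (f n - f m)"
        by (simp add: blinfun.diff_left cinner_diff_right cinner_projection_self proj f_def)
      finally show ?thesis using of_real_eq_iff by blast
    qed
    have "incseq f"
      using diff by (metis (no_types) diff_ge_0_iff_ge incseq_def zero_le_power2)
    moreover have "f n \<le> (norm x)\<^sup>2" for n
      using norm_projection_le[OF proj] by (simp add: f_def power_mono)
    ultimately have "Cauchy f"
      by (metis incseq_convergent LIMSEQ_imp_Cauchy)
    have "Cauchy (\<lambda>n. s n x)"
    proof (rule metric_CauchyI)
      fix \<epsilon> :: real assume "\<epsilon> > 0"
      then obtain M where M: "\<And>m n. m \<ge> M \<Longrightarrow> n \<ge> M \<Longrightarrow> dist (f m) (f n) < \<epsilon>\<^sup>2"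
        using metric_CauchyD[OF \<open>Cauchy f\<close>, of "\<epsilon>\<^sup>2"] by auto
      have *: "norm (s n x - s m x) < \<epsilon>" if "m \<ge> M" "m \<le> n" for m n
      proof -
        have "(norm (s n x - s m x))\<^sup>2 < \<epsilon>\<^sup>2"
          using M[of n m] that diff[of m n] by (auto simp: dist_real_def)
        then show ?thesis using \<open>\<epsilon> > 0\<close> by (simp add: power2_less_imp_less)
      qed
      have "dist (s m x) (s n x) < \<epsilon>" if "m \<ge> M" "n \<ge> M" for m n
        using *[of m n] *[of n m] that by (cases "m \<le> n") (auto simp: dist_norm norm_minus_commute)
      then show "\<exists>M. \<forall>m\<ge>M. \<forall>n\<ge>M. dist (s m x) (s n x) < \<epsilon>" by blast
    qed
    then show ?thesis by (simp add: Cauchy_convergent_iff)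
  qed
  define Q where "Q x = lim (\<lambda>n. s n x)" for x
  have lim: "(\<lambda>n. s n x) \<longlonglongrightarrow> Q x" for x
    using conv[of x] by (simp add: Q_def convergent_LIMSEQ_iff)
  have "bounded_linear Q"
  proof (rule bounded_linear_intro[where K = 1])
    show "Q (x + y) = Q x + Q y" for x y
      using lim[of "x + y"] tendsto_add[OF lim[of x] lim[of y]]
      by (simp add: blinfun.add_right LIMSEQ_unique)
    show "Q (r *\<^sub>R x) = r *\<^sub>R Q x" for r x
      using lim[of "r *\<^sub>R x"] tendsto_scaleR[OF tendsto_const lim[of x], of r]
      by (simp add: blinfun.scaleR_right LIMSEQ_unique)
    show "norm (Q x) \<le> norm x * 1" for x
      using tendsto_norm[OF lim[of x]] norm_projection_le[OF proj]
      by (auto intro: LIMSEQ_le_const2)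
  qed
  then have P: "blinfun_apply (Blinfun Q) = Q" by (rule bounded_linear_Blinfun_apply)
  have "projection (Blinfun Q)"
  proof (rule projectionI, unfold P)
    show "Q (scaleC c x) = scaleC c (Q x)" for c x
      using lim[of "scaleC c x"] bounded_linear.tendsto[OF bounded_linear_scaleC lim[of x], of c]
      by (simp add: projection_scaleC[OF proj] LIMSEQ_unique)
    show "cinner (Q x) y = cinner x (Q y)" for x y
      using tendsto_cinner_left[OF lim[of x], of y] tendsto_cinner_right[OF lim[of y], of x]
      by (simp add: projection_cinner[OF proj] LIMSEQ_unique)
    show "Q (Q x) = Q x" for x
    proof -
      have "s m (Q x) = s m x" for m
      proof -
        have "s m o\<^sub>L s n = s m" if "m \<le> n" for n
          by (intro projection_absorb_commute proj mono that)
        then have "\<forall>\<^sub>F n in sequentially. s m (s n x) = s m x"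
          by (metis (mono_tags, lifting) blinfun_apply_blinfun_compose eventually_sequentially)
        then have "(\<lambda>n. s m (s n x)) \<longlonglongrightarrow> s m x" by (simp add: tendsto_eventually)
        with blinfun.tendsto[OF tendsto_const lim[of x], of "s m"] show ?thesis
          using LIMSEQ_unique by blast
      qed
      with lim[of "Q x"] lim[of x] show ?thesis by (simp add: LIMSEQ_unique)
    qed
  qed
  with lim show ?thesis by (intro that[of "Blinfun Q"]) (simp_all add: P)
qed

lemma projection_limit_absorbs:
  fixes s :: "nat \<Rightarrow> 'h::chilbert_space \<Rightarrow>\<^sub>L 'h" and P :: "'h \<Rightarrow>\<^sub>L 'h"
  assumes mono: "\<And>m n. m \<le> n \<Longrightarrow> s n o\<^sub>L s m = s m"
    and lim: "\<And>x. (\<lambda>n. s n x) \<longlonglongrightarrow> P x"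
  shows "P o\<^sub>L s m = s m"
proof (rule blinfun_eqI)
  fix x
  have "\<forall>\<^sub>F n in sequentially. s n (s m x) = s m x"
    using mono by (metis (mono_tags, lifting) blinfun_apply_blinfun_compose eventually_sequentially)
  then have "(\<lambda>n. s n (s m x)) \<longlonglongrightarrow> s m x" by (simp add: tendsto_eventually)
  with lim[of "s m x"] show "(P o\<^sub>L s m) x = s m x" by (simp add: LIMSEQ_unique)
qed

text \<open>
  Normality of a functional speaks about suprema in the operator order; this is the bridge to
  strong limits.
\<close>

lemma supremum_increasing_projections:
  fixes s :: "nat \<Rightarrow> 'h::chilbert_space \<Rightarrow>\<^sub>L 'h" and P :: "'h \<Rightarrow>\<^sub>L 'h"
  assumes "P \<in> N" and P: "projection P" and proj: "\<And>n. projection (s n)"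
    and mono: "\<And>m n. m \<le> n \<Longrightarrow> s n o\<^sub>L s m = s m"
    and lim: "\<And>x. (\<lambda>n. s n x) \<longlonglongrightarrow> P x"
  shows "supremum_in N (range s) P"
  unfolding supremum_in_def
proof (intro conjI ballI impI)
  show "P \<in> N" by fact
  show "op_le S P" if "S \<in> range s" for S
    using that unfolding op_le_def
    by (auto intro!: positive_projection projection_diff P proj projection_limit_absorbs[OF mono lim])
  fix U assume "\<forall>S\<in>range s. op_le S U"
  then have U: "cinner x (U x) - cinner x (s n x) \<in> \<real>" "0 \<le> Re (cinner x (U x) - cinner x (s n x))"
    for x n
    by (auto simp: op_le_def positive_op_def blinfun.diff_left cinner_diff_right)
  have lim': "(\<lambda>n. cinner x (U x) - cinner x (s n x)) \<longlonglongrightarrow> cinner x (U x) - cinner x (P x)" for x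
    by (intro tendsto_intros tendsto_cinner_right lim)
  show "op_le P U"
    unfolding op_le_def positive_op_def
  proof (intro allI conjI)
    fix x
    have "cinner x (U x) - cinner x (P x) \<in> \<real>"
      using closed_sequentially[OF closed_complex_Reals _ lim'] U(1) by blast
    then show "cinner x ((U - P) x) \<in> \<real>" by (simp add: blinfun.diff_left cinner_diff_right)
    have "0 \<le> Re (cinner x (U x) - cinner x (P x))"
      by (rule LIMSEQ_le_const[OF tendsto_Re[OF lim']]) (use U(2) in blast)
    then show "0 \<le> Re (cinner x ((U - P) x))" by (simp add: blinfun.diff_left cinner_diff_right)
  qed
qed

text \<open>A sum of mutually orthogonal projections is the limit of its increasing partial sums.\<close>

lemma orthogonal_partial_sums:
  fixes r :: "nat \<Rightarrow> 'h::chilbert_space \<Rightarrow>\<^sub>L 'h"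
  assumes proj: "\<And>k. projection (r k)" and orth: "\<And>j k. j \<noteq> k \<Longrightarrow> r j o\<^sub>L r k = 0"
  defines "s \<equiv> \<lambda>n. \<Sum>k<n. r k"
  shows "projection (s n)" and "m \<le> n \<Longrightarrow> s n o\<^sub>L s m = s m"
proof -
  have app: "s n x = (\<Sum>k<n. r k x)" for n x
    by (simp add: s_def blinfun.sum_left)
  have orth': "r j (r k x) = 0" if "j \<noteq> k" for j k x
    using orth[OF that] by (metis blinfun_apply_blinfun_compose zero_blinfun.rep_eq)
  have sr: "s n o\<^sub>L r k = 0" if "n \<le> k" for n k
    by (rule blinfun_eqI) (use that in \<open>auto simp: app orth' intro!: sum.neutral\<close>)
  show *: "projection (s n)" for n
  proof (induction n)
    case 0
    show ?case by (simp add: s_def projection_zero)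
  next
    case (Suc n)
    have "s (Suc n) = s n + r n" by (simp add: s_def)
    then show ?case using projection_add[OF Suc proj[of n] sr[of n n]] by simp
  qed
  show "s n o\<^sub>L s m = s m" if "m \<le> n"
    using that
  proof (induction n rule: dec_induct)
    case base
    show ?case by (rule blinfun_eqI) (simp add: projection_idem[OF *])
  next
    case (step n)
    have "r n o\<^sub>L s m = 0" by (rule projection_orthogonal_commute[OF * proj sr]) (use step in simp)
    moreover have "s (Suc n) = s n + r n" by (simp add: s_def)
    ultimately show ?case using step.IH
      by (simp add: bounded_bilinear.add_left[OF bounded_bilinear_blinfun_compose])
  qed
qed

lemma orthogonal_projections_sum:
  fixes r :: "nat \<Rightarrow> 'h::chilbert_space \<Rightarrow>\<^sub>L 'h"
  assumes N: "von_neumann_algebra N e" and mem: "\<And>k. r k \<in> N"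
    and proj: "\<And>k. projection (r k)" and orth: "\<And>j k. j \<noteq> k \<Longrightarrow> r j o\<^sub>L r k = 0"
  obtains P where "P \<in> N" "projection P" "\<And>x. (\<lambda>k. r k x) sums P x"
proof -
  define s where "s n = (\<Sum>k<n. r k)" for n
  have s: "projection (s n)" for n
    unfolding s_def by (rule orthogonal_partial_sums(1)[of r, OF proj orth])
  have mono: "s n o\<^sub>L s m = s m" if "m \<le> n" for m n
    unfolding s_def by (rule orthogonal_partial_sums(2)[of r, OF proj orth that])
  obtain P where P: "projection P" "\<And>x. (\<lambda>n. s n x) \<longlonglongrightarrow> P x"
    using increasing_projections_converge[of s, OF s mono] by blast
  have "s n \<in> N" for n unfolding s_def by (rule vna_sum[OF N mem])
  then have "P \<in> N"
    using P vna_strong_limit[OF N, of P s] by (simp add: projection_def)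
  with P show ?thesis by (intro that[of P]) (simp_all add: sums_def s_def blinfun.sum_left)
qed


section \<open>Projections of prescribed trace\<close>

lemma blinfun_compose_assoc: "(R o\<^sub>L S) o\<^sub>L T = R o\<^sub>L (S o\<^sub>L T)"
  by (rule blinfun_eqI) simp

lemma blinfun_compose_diff_left: "(R - S) o\<^sub>L T = (R o\<^sub>L T) - (S o\<^sub>L T)"
  by (rule bounded_bilinear.diff_left[OF bounded_bilinear_blinfun_compose])

lemma blinfun_compose_diff_right: "R o\<^sub>L (S - T) = (R o\<^sub>L S) - (R o\<^sub>L T)"
  by (rule bounded_bilinear.diff_right[OF bounded_bilinear_blinfun_compose])

lemma blinfun_compose_add_left: "(R + S) o\<^sub>L T = (R o\<^sub>L T) + (S o\<^sub>L T)"
  by (rule bounded_bilinear.add_left[OF bounded_bilinear_blinfun_compose])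

lemma projection_compose_self: "projection p \<Longrightarrow> p o\<^sub>L p = p"
  by (simp add: projection_def)

locale traced_algebra =
  fixes M :: "('h::chilbert_space \<Rightarrow>\<^sub>L 'h) set" and e :: "'h \<Rightarrow>\<^sub>L 'h"
    and \<tau> :: "('h \<Rightarrow>\<^sub>L 'h) \<Rightarrow> complex"
  assumes M: "von_neumann_algebra M e"
    and trace: "normalized_faithful_normal_trace M e \<tau>"
begin

lemma trace_add: "S \<in> M \<Longrightarrow> T \<in> M \<Longrightarrow> \<tau> (S + T) = \<tau> S + \<tau> T"
  and trace_scaleC: "T \<in> M \<Longrightarrow> \<tau> (scaleC_op c T) = c * \<tau> T"
  and trace_commute: "S \<in> M \<Longrightarrow> T \<in> M \<Longrightarrow> \<tau> (S o\<^sub>L T) = \<tau> (T o\<^sub>L S)"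
  and trace_positive: "T \<in> M \<Longrightarrow> positive_op T \<Longrightarrow> \<tau> T \<in> \<real> \<and> 0 \<le> Re (\<tau> T)"
  and trace_faithful: "T \<in> M \<Longrightarrow> positive_op T \<Longrightarrow> \<tau> T = 0 \<Longrightarrow> T = 0"
  and trace_normal: "normal_functional M \<tau>"
  using trace
  by (simp_all add: normalized_faithful_normal_trace_def clinear_functional_def
      positive_functional_def)

lemma trace_diff:
  assumes "S \<in> M" "T \<in> M"
  shows "\<tau> (S - T) = \<tau> S - \<tau> T"
  using trace_add[OF vna_diff[OF M assms] assms(2)] by simp

lemma trace_zero: "\<tau> 0 = 0"
  using trace_diff[OF vna_unit[OF M] vna_unit[OF M]] by simp

lemma trace_projection:
  assumes "q \<in> M" "projection q"
  shows "\<tau> q = complex_of_real (Re (\<tau> q))" "0 \<le> Re (\<tau> q)"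
  using trace_positive[OF assms(1) positive_projection[OF assms(2)]] by simp_all

lemma trace_projection_pos:
  assumes "q \<in> M" "projection q" "q \<noteq> 0"
  shows "0 < Re (\<tau> q)"
proof -
  have "\<tau> q \<noteq> 0"
    using trace_faithful[OF assms(1) positive_projection[OF assms(2)]] assms(3) by blast
  then have "Re (\<tau> q) \<noteq> 0" by (metis trace_projection(1)[OF assms(1,2)] of_real_0)
  with trace_projection(2)[OF assms(1,2)] show ?thesis by simp
qed

lemma trace_increasing_limit:
  fixes s :: "nat \<Rightarrow> 'h \<Rightarrow>\<^sub>L 'h" and P :: "'h \<Rightarrow>\<^sub>L 'h"
  assumes P: "P \<in> M" "projection P" and s: "\<And>n. s n \<in> M" "\<And>n. projection (s n)"
    and mono: "\<And>m n. m \<le> n \<Longrightarrow> s n o\<^sub>L s m = s m"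
    and lim: "\<And>x. (\<lambda>n. s n x) \<longlonglongrightarrow> P x"
  shows "Re (\<tau> P) = (SUP n. Re (\<tau> (s n)))"
proof -
  have le: "op_le (s m) (s n)" if "m \<le> n" for m n
    unfolding op_le_def by (intro positive_projection projection_diff s mono that)
  have "\<forall>S\<in>range s. \<forall>S'\<in>range s. \<exists>U\<in>range s. op_le S U \<and> op_le S' U"
  proof (intro ballI)
    fix S S' assume "S \<in> range s" "S' \<in> range s"
    then obtain m n where "S = s m" "S' = s n" by blast
    then show "\<exists>U\<in>range s. op_le S U \<and> op_le S' U"
      using le[of m "max m n"] le[of n "max m n"] by auto
  qed
  moreover have "supremum_in M (range s) P"
    by (rule supremum_increasing_projections[OF P s(2) mono lim])
  moreover have "range s \<subseteq> M" "range s \<noteq> {}" "\<forall>S\<in>range s. positive_op S"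
    using s positive_projection by auto
  ultimately have "Re (\<tau> P) = (SUP S\<in>range s. Re (\<tau> S))"
    using trace_normal unfolding normal_functional_def by blast
  then show ?thesis by (simp add: image_comp)
qed

lemma trace_projection_mono:
  assumes "q \<in> M" "projection q" "r \<in> M" "projection r" "q o\<^sub>L r = r"
  shows "Re (\<tau> r) \<le> Re (\<tau> q)"
  using trace_projection(2)[OF vna_diff[OF M assms(1,3)] projection_diff[OF assms(2,4,5)]]
  by (simp add: trace_diff assms)

context
  fixes B :: "('h \<Rightarrow>\<^sub>L 'h) set" and p :: "'h \<Rightarrow>\<^sub>L 'h"
  assumes B: "von_neumann_algebra B p" and BM: "B \<subseteq> M" and diffuse: "diffuse B"
    and p: "projection p"
begin

text \<open>
  As \<open>q\<close> is not minimal, it splits into two nonzero orthogonal projections of \<open>B\<close>; one of the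
  two carries at most half of the trace.
\<close>

lemma diffuse_halve:
  assumes q: "q \<in> B" "projection q" "q \<noteq> 0"
  obtains r where "r \<in> B" "projection r" "r \<noteq> 0" "q o\<^sub>L r = r" "Re (\<tau> r) \<le> Re (\<tau> q) / 2"
proof -
  obtain r where r: "r \<in> B" "projection r" "op_le r q" "r \<noteq> 0" "r \<noteq> q"
    using diffuse q unfolding diffuse_def minimal_projection_def by blast
  have qr: "q o\<^sub>L r = r" by (rule op_le_projection_absorb[OF q(2) r(2,3)])
  have "\<tau> (q - r) = \<tau> q - \<tau> r" using trace_diff q r BM by blast
  then consider "Re (\<tau> r) \<le> Re (\<tau> q) / 2" | "Re (\<tau> (q - r)) \<le> Re (\<tau> q) / 2"
    by fastforce
  then show thesis
  proof cases
    case 1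
    then show thesis using that r qr by blast
  next
    case 2
    show thesis
    proof (rule that[OF _ _ _ _ 2])
      show "q - r \<in> B" by (rule vna_diff[OF B q(1) r(1)])
      show "projection (q - r)" by (rule projection_diff[OF q(2) r(2) qr])
      show "q - r \<noteq> 0" using r by simp
      show "q o\<^sub>L (q - r) = q - r"
        by (simp add: blinfun_compose_diff_right qr projection_compose_self q)
    qed
  qed
qed

lemma diffuse_small_projection:
  assumes q: "q \<in> B" "projection q" "q \<noteq> 0" and "\<epsilon> > 0"
  obtains r where "r \<in> B" "projection r" "r \<noteq> 0" "q o\<^sub>L r = r" "Re (\<tau> r) < \<epsilon>"
proof -
  have *: "\<exists>r\<in>B. projection r \<and> r \<noteq> 0 \<and> q o\<^sub>L r = r \<and> Re (\<tau> r) \<le> Re (\<tau> q) / 2 ^ n" for n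
  proof (induction n)
    case 0
    then show ?case using q projection_compose_self by auto
  next
    case (Suc n)
    then obtain r where r: "r \<in> B" "projection r" "r \<noteq> 0" "q o\<^sub>L r = r"
      "Re (\<tau> r) \<le> Re (\<tau> q) / 2 ^ n" by blast
    then obtain r' where r': "r' \<in> B" "projection r'" "r' \<noteq> 0" "r o\<^sub>L r' = r'"
      "Re (\<tau> r') \<le> Re (\<tau> r) / 2" using diffuse_halve by blast
    have "q o\<^sub>L r' = r'" by (metis blinfun_compose_assoc r(4) r'(4))
    moreover have "Re (\<tau> r') \<le> Re (\<tau> q) / 2 ^ Suc n" using r(5) r'(5) by simp
    ultimately show ?case using r' by blast
  qed
  have "(\<lambda>n. Re (\<tau> q) / 2 ^ n) \<longlonglongrightarrow> 0" by (rule LIMSEQ_divide_realpow_zero) simp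
  then obtain n where "Re (\<tau> q) / 2 ^ n < \<epsilon>"
    using \<open>\<epsilon> > 0\<close> by (metis (mono_tags) order_tendstoD(2) eventually_sequentially order_refl)
  with *[of n] that show thesis by fastforce
qed

text \<open>
  Greedy exhaustion. Increase \<open>s n\<close> inside \<open>B\<close>, keeping the trace below \<open>t\<close> and realizing at
  each step at least half of the largest possible gain. By normality the limit \<open>P\<close> still has
  trace at most \<open>t\<close>. If it were smaller than \<open>t\<close>, diffuseness would provide a nonzero
  projection \<open>r\<close> below the complement of \<open>P\<close> with \<open>\<tau> P + \<tau> r \<le> t\<close>. Then the gain \<open>\<tau> r\<close> would have
  been possible at every step, although the realized gains tend to zero.
\<close>

lemma diffuse_prescribed_trace:
  assumes t: "0 \<le> t" "t \<le> Re (\<tau> p)"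
  obtains q where "q \<in> B" "projection q" "Re (\<tau> q) = t"
proof -
  \<comment> \<open>\<open>C s\<close> consists of the admissible successors of \<open>s\<close>.\<close>
  define C :: "('h \<Rightarrow>\<^sub>L 'h) \<Rightarrow> ('h \<Rightarrow>\<^sub>L 'h) set" where "C s = {u \<in> B. projection u \<and> u o\<^sub>L s = s \<and> Re (\<tau> u) \<le> t}" for s
  have step: "\<exists>s'. s' \<in> C s \<and> (\<forall>u\<in>C s. Re (\<tau> u) - Re (\<tau> s) \<le> 2 * (Re (\<tau> s') - Re (\<tau> s)))"
    if s: "s \<in> B" "projection s" "Re (\<tau> s) \<le> t" for s
  proof -
    define X where "X = (\<lambda>u. Re (\<tau> u)) ` C s"
    have "s \<in> C s" using s projection_compose_self by (simp add: C_def)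
    then have sX: "Re (\<tau> s) \<in> X" by (auto simp: X_def)
    have bdd: "bdd_above X" by (rule bdd_aboveI[of _ t]) (auto simp: X_def C_def)
    show ?thesis
    proof (cases "Sup X \<le> Re (\<tau> s)")
      \<comment> \<open>No gain is possible at all, and staying at \<open>s\<close> is optimal.\<close>
      case True
      then have "\<forall>u\<in>C s. Re (\<tau> u) \<le> Re (\<tau> s)"
        using cSup_upper[OF _ bdd] by (force simp: X_def)
      with \<open>s \<in> C s\<close> show ?thesis by (intro exI[of _ s]) auto
    next
      case False
      then have "(Sup X + Re (\<tau> s)) / 2 < Sup X" by simp
      moreover have "X \<noteq> {}" using sX by blast
      ultimately obtain y where y: "y \<in> X" "(Sup X + Re (\<tau> s)) / 2 < y"
        using less_cSupE by blast
      then obtain s' where s': "s' \<in> C s" "(Sup X + Re (\<tau> s)) / 2 < Re (\<tau> s')"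
        unfolding X_def by blast
      have "Re (\<tau> u) \<le> Sup X" if "u \<in> C s" for u
        using cSup_upper[OF _ bdd] that by (auto simp: X_def)
      with s' show ?thesis by (intro exI[of _ s']) force
    qed
  qed
  have "\<exists>s. \<forall>n. (s n \<in> B \<and> projection (s n) \<and> Re (\<tau> (s n)) \<le> t) \<and>
     (s (Suc n) \<in> C (s n) \<and>
      (\<forall>u\<in>C (s n). Re (\<tau> u) - Re (\<tau> (s n)) \<le> 2 * (Re (\<tau> (s (Suc n))) - Re (\<tau> (s n)))))"
  proof (rule dependent_nat_choice)
    show "\<exists>s. s \<in> B \<and> projection s \<and> Re (\<tau> s) \<le> t"
      using vna_zero[OF B] projection_zero t(1) trace_zero by (intro exI[of _ 0]) simp
  next
    fix s :: "'h \<Rightarrow>\<^sub>L 'h" and n :: nat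
    assume s: "s \<in> B \<and> projection s \<and> Re (\<tau> s) \<le> t"
    then obtain s' where "s' \<in> C s" "\<forall>u\<in>C s. Re (\<tau> u) - Re (\<tau> s) \<le> 2 * (Re (\<tau> s') - Re (\<tau> s))"
      using step by blast
    then show "\<exists>s'. (s' \<in> B \<and> projection s' \<and> Re (\<tau> s') \<le> t) \<and> s' \<in> C s \<and>
        (\<forall>u\<in>C s. Re (\<tau> u) - Re (\<tau> s) \<le> 2 * (Re (\<tau> s') - Re (\<tau> s)))"
      by (auto simp: C_def)
  qed
  then obtain s :: "nat \<Rightarrow> 'h \<Rightarrow>\<^sub>L 'h"
    where s: "\<And>n. s n \<in> B" "\<And>n. projection (s n)" "\<And>n. Re (\<tau> (s n)) \<le> t"
      and next_s: "\<And>n. s (Suc n) \<in> C (s n)"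
      and gain: "\<And>n u. u \<in> C (s n) \<Longrightarrow> Re (\<tau> u) - Re (\<tau> (s n)) \<le> 2 * (Re (\<tau> (s (Suc n))) - Re (\<tau> (s n)))"
    by blast
  have sM: "s n \<in> M" for n using s BM by blast
  have mono: "s n o\<^sub>L s m = s m" if "m \<le> n" for m n
    using that
  proof (induction n rule: dec_induct)
    case base
    show ?case by (rule projection_compose_self[OF s(2)])
  next
    case (step n)
    have "s (Suc n) o\<^sub>L s n = s n" using next_s[of n] by (simp add: C_def)
    then show ?case by (metis blinfun_compose_assoc step.IH)
  qed
  obtain P :: "'h \<Rightarrow>\<^sub>L 'h" where P: "projection P" and lim: "\<And>x. (\<lambda>n. s n x) \<longlonglongrightarrow> P x"
    using increasing_projections_converge[of s, OF s(2) mono] by blast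
  have PB: "P \<in> B"
    using P by (intro vna_strong_limit[OF B _ s(1) lim]) (simp add: projection_def)
  then have PM: "P \<in> M" using BM by blast
  have Ps: "P o\<^sub>L s n = s n" for n by (rule projection_limit_absorbs[OF mono lim])
  have trP: "Re (\<tau> P) = (SUP n. Re (\<tau> (s n)))"
    by (rule trace_increasing_limit[OF PM P sM s(2) mono lim])
  have "Re (\<tau> P) \<le> t" unfolding trP by (rule cSUP_least) (use s(3) in auto)
  moreover have "\<not> Re (\<tau> P) < t"
  proof
    assume less: "Re (\<tau> P) < t"
    have pP: "p o\<^sub>L P = P" by (rule vna_unit_left[OF B PB])
    have "p - P \<in> B" by (rule vna_diff[OF B vna_unit[OF B] PB])
    moreover have "projection (p - P)" by (rule projection_diff[OF p P pP])
    moreover have "p - P \<noteq> 0" using less t by auto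
    ultimately obtain r where r: "r \<in> B" "projection r" "r \<noteq> 0" "(p - P) o\<^sub>L r = r"
      "Re (\<tau> r) < t - Re (\<tau> P)"
      using diffuse_small_projection less by (metis diff_gt_0_iff_gt)
    have rM: "r \<in> M" using r BM by blast
    have Pr: "P o\<^sub>L r = 0"
      using r(4) vna_unit_left[OF B r(1)] by (simp add: blinfun_compose_diff_left)
    have rP: "r o\<^sub>L P = 0" by (rule projection_orthogonal_commute[OF P r(2) Pr])
    have tr: "Re (\<tau> (P + r)) = Re (\<tau> P) + Re (\<tau> r)" using trace_add[OF PM rM] by simp
    have eligible: "P + r \<in> C (s n)" for n
    proof -
      have "r o\<^sub>L s n = 0" by (metis Ps blinfun_compose_assoc blinfun_compose_zero(1) rP)
      then have "(P + r) o\<^sub>L s n = s n" by (simp add: blinfun_compose_add_left Ps)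
      then show ?thesis
        using vna_add[OF B PB r(1)] projection_add[OF P r(2) Pr] r(5) tr by (simp add: C_def)
    qed
    have "Re (\<tau> r) \<le> 2 * (Re (\<tau> (s (Suc n))) - Re (\<tau> (s n)))" for n
      using gain[OF eligible[of n]] trace_projection_mono[OF PM P sM s(2) Ps, of n] tr by linarith
    moreover have "(\<lambda>n. 2 * (Re (\<tau> (s (Suc n))) - Re (\<tau> (s n)))) \<longlonglongrightarrow> 0"
    proof -
      have "incseq (\<lambda>n. Re (\<tau> (s n)))"
        using trace_projection_mono[OF sM s(2) sM s(2) mono] by (simp add: incseq_def)
      then obtain L where L: "(\<lambda>n. Re (\<tau> (s n))) \<longlonglongrightarrow> L"
        using incseq_convergent[of _ t] s(3) by blast
      show ?thesis
        using tendsto_mult[OF tendsto_const[of 2] tendsto_diff[OF LIMSEQ_Suc[OF L] L]] by simp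
    qed
    ultimately have "Re (\<tau> r) \<le> 0" by (auto intro: LIMSEQ_le_const)
    with trace_projection_pos[OF rM r(2,3)] show False by simp
  qed
  ultimately show thesis using that[OF PB P] by simp
qed

end

section \<open>Conditional expectations\<close>

text \<open>
  If \<open>d\<close> is the difference of the two sides, then \<open>\<tau> (d d\<^sup>*) = 0\<close>, because \<open>d\<^sup>*\<close> lies in \<open>A\<close>;
  faithfulness of the trace gives \<open>d = 0\<close>.
\<close>

lemma conditional_expectation_eqI:
  assumes E: "conditional_expectation M \<tau> A E" and A: "von_neumann_algebra A e" "A \<subseteq> M"
    and x: "x \<in> M" and y: "y \<in> A"
    and eq: "\<And>b. b \<in> A \<Longrightarrow> \<tau> (x o\<^sub>L b) = \<tau> (y o\<^sub>L b)"
  shows "E x = y"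
proof -
  have Ex: "E x \<in> A" using E x by (simp add: conditional_expectation_def)
  then have "E x - y \<in> A" by (intro vna_diff[OF A(1)] y)
  then obtain b where b: "b \<in> A" "is_adjoint (E x - y) b" using vna_adjoint[OF A(1)] by blast
  have adj: "cinner (b u) v = cinner u ((E x - y) v)" for u v
    using b(2) by (simp add: is_adjoint_def)
  have bM: "b \<in> M" "E x \<in> M" "y \<in> M" using b Ex y A(2) by auto
  have "\<tau> (E x o\<^sub>L b) = \<tau> (x o\<^sub>L b)"
  proof -
    have "E (e o\<^sub>L x o\<^sub>L b) = e o\<^sub>L E x o\<^sub>L b"
      using E vna_unit[OF A(1)] x b(1) by (simp add: conditional_expectation_def)
    then have "E (x o\<^sub>L b) = E x o\<^sub>L b"
      by (simp add: vna_unit_left[OF M x] vna_unit_left[OF M bM(2)])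
    then show ?thesis
      using E vna_compose[OF M x bM(1)] unfolding conditional_expectation_def by metis
  qed
  then have "\<tau> ((E x - y) o\<^sub>L b) = 0"
    by (simp add: blinfun_compose_diff_left trace_diff vna_compose[OF M] bM eq b(1))
  moreover have "positive_op ((E x - y) o\<^sub>L b)"
    unfolding positive_op_def by (simp add: adj[symmetric] cinner_self)
  moreover have "(E x - y) o\<^sub>L b \<in> M" by (intro vna_compose[OF M] vna_diff[OF M] bM)
  ultimately have "(E x - y) o\<^sub>L b = 0" using trace_faithful by blast
  then have "cinner (b u) (b u) = 0" for u
    by (metis adj blinfun_apply_blinfun_compose cinner_zero_right zero_blinfun.rep_eq)
  then have "b u = 0" for u by (simp add: cinner_self)
  then have "cinner u ((E x - y) v) = cinner u 0" for u v
    using adj[of u v] by (simp add: cinner_zero_left cinner_zero_right)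
  then have "(E x - y) v = 0" for v using cinner_left_eqI by blast
  then show ?thesis by (intro blinfun_eqI) (simp add: blinfun.diff_left)
qed

text \<open>
  Let \<open>B\<close> be the diffuse algebra orthogonal to \<open>p A\<close>. On \<open>B\<close> the expectation onto \<open>p A\<close> is
  determined by the trace, so any \<open>q \<in> B\<close> of trace \<open>t \<tau> p\<close> is sent to \<open>t p\<close>. The expectation \<open>E\<close>
  of the whole algebra does the same, since \<open>\<tau> (q b) = \<tau> (q (p b))\<close> for \<open>b \<in> A\<close>.
\<close>

lemma projection_expectation_scalar:
  assumes E: "conditional_expectation M \<tau> A E"
    and A: "von_neumann_algebra A e" "A \<subseteq> M" "abelian A"
    and compl: "totally_complementable M \<tau> A"
    and p: "p \<in> A" "projection p" "p \<noteq> 0" and t: "0 \<le> t" "t \<le> 1"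
  obtains q where "q \<in> M" "projection q" "p o\<^sub>L q = q" "E q = scaleC_op (complex_of_real t) p"
proof -
  obtain B E' where B: "von_neumann_algebra B p" "B \<subseteq> corner M p" "diffuse B"
    and E': "conditional_expectation (corner M p) \<tau> ((\<lambda>a. p o\<^sub>L a) ` A) E'"
    and scalar: "E' ` B \<subseteq> range (\<lambda>c. scaleC_op c p)"
    using compl p unfolding totally_complementable_def orthogonal_subalgebras_def by blast
  have pM: "p \<in> M" using p A by blast
  have corner_M: "corner M p \<subseteq> M"
    unfolding corner_def using vna_compose[OF M] pM by blast
  have "0 \<le> t * Re (\<tau> p)" "t * Re (\<tau> p) \<le> Re (\<tau> p)"
    using trace_projection(2)[OF pM p(2)] t by (auto intro: mult_left_le_one_le)
  then obtain q where q: "q \<in> B" "projection q" "Re (\<tau> q) = t * Re (\<tau> p)"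
    using diffuse_prescribed_trace[OF B(1) _ B(3) p(2)] B(2) corner_M by blast
  have qc: "q \<in> corner M p" and qM: "q \<in> M" using q(1) B(2) corner_M by auto
  have pq: "p o\<^sub>L q = q" by (rule vna_unit_left[OF B(1) q(1)])
  obtain c where c: "E' q = scaleC_op c p" using scalar q(1) by blast
  have "\<tau> q = \<tau> (E' q)" using E' qc unfolding conditional_expectation_def by metis
  then have "\<tau> q = c * \<tau> p" by (simp add: c trace_scaleC pM)
  moreover have "\<tau> q = complex_of_real t * \<tau> p"
    by (metis of_real_mult q(3) trace_projection(1) pM p(2) qM q(2))
  moreover have "\<tau> p \<noteq> 0" using trace_projection_pos[OF pM p(2,3)] by auto
  ultimately have ct: "c = complex_of_real t" by simp
  have "E q = scaleC_op c p"
  proof (rule conditional_expectation_eqI[OF E A(1,2) qM vna_scaleC[OF A(1) p(1)]])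
    fix b assume b: "b \<in> A"
    have bM: "b \<in> M" using b A by blast
    have bp: "b o\<^sub>L p = p o\<^sub>L b" using A(3) b p(1) by (simp add: abelian_def)
    have "\<tau> (q o\<^sub>L b) = \<tau> (p o\<^sub>L (q o\<^sub>L b))" by (simp add: blinfun_compose_assoc[symmetric] pq)
    also have "\<dots> = \<tau> ((q o\<^sub>L b) o\<^sub>L p)" by (rule trace_commute[OF pM vna_compose[OF M qM bM]])
    also have "(q o\<^sub>L b) o\<^sub>L p = p o\<^sub>L q o\<^sub>L (p o\<^sub>L b)" by (simp add: blinfun_compose_assoc bp pq flip: blinfun_compose_assoc[of p q])
    also have "\<tau> (p o\<^sub>L q o\<^sub>L (p o\<^sub>L b)) = \<tau> (E' (p o\<^sub>L q o\<^sub>L (p o\<^sub>L b)))"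
    proof -
      have "p o\<^sub>L q o\<^sub>L (p o\<^sub>L b) = p o\<^sub>L (q o\<^sub>L b) o\<^sub>L p" by (simp add: blinfun_compose_assoc bp)
      then have "p o\<^sub>L q o\<^sub>L (p o\<^sub>L b) \<in> corner M p"
        unfolding corner_def using vna_compose[OF M qM bM] by simp
      then show ?thesis using E' unfolding conditional_expectation_def by metis
    qed
    also have "E' (p o\<^sub>L q o\<^sub>L (p o\<^sub>L b)) = p o\<^sub>L E' q o\<^sub>L (p o\<^sub>L b)"
    proof -
      have "p \<in> (\<lambda>a. p o\<^sub>L a) ` A" using p(1) projection_compose_self[OF p(2)] by force
      moreover have "p o\<^sub>L b \<in> (\<lambda>a. p o\<^sub>L a) ` A" using b by blast
      ultimately show ?thesis using E' qc unfolding conditional_expectation_def by blast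
    qed
    also have "p o\<^sub>L E' q o\<^sub>L (p o\<^sub>L b) = scaleC_op c p o\<^sub>L b"
      by (rule blinfun_eqI)
        (simp add: c scaleC_op_apply projection_scaleC[OF p(2)] projection_idem[OF p(2)])
    finally show "\<tau> (q o\<^sub>L b) = \<tau> (scaleC_op c p o\<^sub>L b)" .
  qed
  with ct show thesis using that qM q(2) pq by simp
qed

end

section \<open>Discrete operators\<close>

text \<open>
  The series defining \<open>a\<close>, evaluated on the range of one \<open>p k\<close>, has a single nonzero term.
\<close>

lemma discrete_coefficient:
  fixes p :: "nat \<Rightarrow> 'h::chilbert_space \<Rightarrow>\<^sub>L 'h" and a :: "'h \<Rightarrow>\<^sub>L 'h"
  assumes proj: "\<And>k. projection (p k)" and orth: "\<And>j k. j \<noteq> k \<Longrightarrow> p j o\<^sub>L p k = 0"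
    and a: "\<And>x. (\<lambda>k. scaleC (\<alpha> k) (p k x)) sums a x"
  shows "a o\<^sub>L p k = scaleC_op (\<alpha> k) (p k)"
proof (rule blinfun_eqI)
  fix x
  have "p j (p k x) = 0" if "j \<noteq> k" for j
    using orth[OF that] by (metis blinfun_apply_blinfun_compose zero_blinfun.rep_eq)
  then have "(\<lambda>j. scaleC (\<alpha> j) (p j (p k x))) = (\<lambda>j. if j = k then scaleC (\<alpha> j) (p k x) else 0)"
    by (auto simp: projection_idem[OF proj] scaleC_zero_right)
  then have "(\<lambda>j. scaleC (\<alpha> j) (p j (p k x))) sums scaleC (\<alpha> k) (p k x)"
    using sums_single[of k "\<lambda>j. scaleC (\<alpha> j) (p k x)"] by simp
  with a[of "p k x"] show "(a o\<^sub>L p k) x = scaleC_op (\<alpha> k) (p k) x"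
    by (simp add: sums_unique2 scaleC_op_apply)
qed

text \<open>
  Any nonzero vector \<open>p y\<close> is an eigenvector of \<open>a\<close> with eigenvalue \<open>\<alpha>\<close>, and
  \<open>\<langle>p y, a (p y)\<rangle>\<close> lies between \<open>0\<close> and \<open>\<parallel>p y\<parallel>\<^sup>2\<close>.
\<close>

lemma discrete_coefficient_bounds:
  fixes p a :: "'h::chilbert_space \<Rightarrow>\<^sub>L 'h"
  assumes p: "projection p" "p \<noteq> 0" and ap: "a o\<^sub>L p = scaleC_op \<alpha> p"
    and a: "op_le 0 a" "op_le a id_blinfun"
  obtains t where "\<alpha> = complex_of_real t" "0 \<le> t" "t \<le> 1"
proof -
  obtain y where y: "p y \<noteq> 0" using p(2) by (metis blinfun_eqI zero_blinfun.rep_eq)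
  define c where "c = (norm (p y))\<^sup>2"
  have "c > 0" using y by (simp add: c_def)
  have "a (p y) = scaleC \<alpha> (p y)"
    using ap by (metis blinfun_apply_blinfun_compose scaleC_op_apply)
  then have ip: "cinner (p y) (a (p y)) = \<alpha> * complex_of_real c"
    by (simp add: cinner_scaleC_right cinner_self c_def)
  have "\<alpha> * complex_of_real c \<in> \<real>" "0 \<le> Re (\<alpha> * complex_of_real c)"
    using a(1) ip unfolding op_le_def positive_op_def by (metis diff_zero)+
  then have "Im \<alpha> = 0" "0 \<le> Re \<alpha>"
    using \<open>c > 0\<close> by (auto simp: complex_is_Real_iff zero_le_mult_iff)
  moreover have "0 \<le> Re (complex_of_real c - \<alpha> * complex_of_real c)"
  proof -
    have "cinner (p y) ((id_blinfun - a) (p y)) = complex_of_real c - \<alpha> * complex_of_real c"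
      by (simp add: blinfun.diff_left cinner_diff_right ip) (simp add: cinner_self c_def)
    then show ?thesis using a(2) unfolding op_le_def positive_op_def by metis
  qed
  then have "Re \<alpha> \<le> 1" using \<open>c > 0\<close> by simp
  ultimately show thesis by (intro that[of "Re \<alpha>"]) (auto simp: complex_eq_iff)
qed

theorem theorem3p2:
  fixes M A :: "('h::chilbert_space \<Rightarrow>\<^sub>L 'h) set"
    and \<tau> :: "('h \<Rightarrow>\<^sub>L 'h) \<Rightarrow> complex"
    and E :: "('h \<Rightarrow>\<^sub>L 'h) \<Rightarrow> ('h \<Rightarrow>\<^sub>L 'h)"
    and a :: "'h \<Rightarrow>\<^sub>L 'h"
  assumes "II1_factor M id_blinfun"
    and "normalized_faithful_normal_trace M id_blinfun \<tau>"
    and "masa M id_blinfun A"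
    and "totally_complementable M \<tau> A"
    and "conditional_expectation M \<tau> A E"
    and "discrete_op A a"
    and "op_le 0 a" and "op_le a id_blinfun"
  shows "\<exists>p\<in>M. projection p \<and> E p = a"
proof -
  have M: "von_neumann_algebra M id_blinfun"
    using assms(1) by (simp add: II1_factor_def factor_def)
  interpret traced_algebra M id_blinfun \<tau>
    by unfold_locales (fact M assms(2))+
  have A: "von_neumann_algebra A id_blinfun" "A \<subseteq> M" "abelian A"
    using assms(3) by (simp_all add: masa_def)
  note E = assms(5)
  obtain \<alpha> and p :: "nat \<Rightarrow> 'h \<Rightarrow>\<^sub>L 'h" where p: "\<And>k. p k \<in> A" "\<And>k. projection (p k)"
    and orth: "\<And>j k. j \<noteq> k \<Longrightarrow> p j o\<^sub>L p k = 0"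
    and a: "\<And>x. (\<lambda>k. scaleC (\<alpha> k) (p k x)) sums a x" and aA: "a \<in> A"
    using assms(6) unfolding discrete_op_def by blast
  have ap: "a o\<^sub>L p k = scaleC_op (\<alpha> k) (p k)" for k
    by (rule discrete_coefficient[OF p(2) orth a])
  have E_mult: "E (x o\<^sub>L b) = E x o\<^sub>L b" if "x \<in> M" "b \<in> A" for x b
  proof -
    have "E (id_blinfun o\<^sub>L x o\<^sub>L b) = id_blinfun o\<^sub>L E x o\<^sub>L b"
      using E vna_unit[OF A(1)] that unfolding conditional_expectation_def by blast
    moreover have "E x \<in> M" using E that(1) A(2) unfolding conditional_expectation_def by blast
    ultimately show ?thesis using vna_unit_left[OF M] that(1) by metis
  qed
  \<comment> \<open>Nothing bounds \<open>\<alpha> k\<close> when \<open>p k = 0\<close>; in that case \<open>q k = 0\<close> serves.\<close>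
  have "\<exists>q\<in>M. projection q \<and> p k o\<^sub>L q = q \<and> E q = a o\<^sub>L p k" for k
  proof (cases "p k = 0")
    case True
    have "E 0 = 0"
      using E vna_zero[OF A(1)] unfolding conditional_expectation_def by blast
    then show ?thesis using True vna_zero[OF M] projection_zero by (intro bexI[of _ 0]) auto
  next
    case False
    obtain t where "\<alpha> k = complex_of_real t" "0 \<le> t" "t \<le> 1"
      using discrete_coefficient_bounds[OF p(2) False ap assms(7,8)] by blast
    then show ?thesis
      using projection_expectation_scalar[OF E A assms(4) p(1,2) False] ap by metis
  qed
  then obtain q :: "nat \<Rightarrow> 'h \<Rightarrow>\<^sub>L 'h" where q: "\<And>k. q k \<in> M" "\<And>k. projection (q k)"
    and pq: "\<And>k. p k o\<^sub>L q k = q k" and Eq: "\<And>k. E (q k) = a o\<^sub>L p k"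
    by metis
  \<comment> \<open>Orthogonality passes from the \<open>p k\<close> to the \<open>q k\<close> below them.\<close>
  have qp: "q k o\<^sub>L p k = q k" for k by (rule projection_absorb_commute[OF p(2) q(2) pq])
  have qp0: "q j o\<^sub>L p k = 0" if "j \<noteq> k" for j k
  proof -
    have "q j o\<^sub>L p k = q j o\<^sub>L (p j o\<^sub>L p k)" by (simp add: qp flip: blinfun_compose_assoc)
    then show ?thesis using orth[OF that] by simp
  qed
  have qq: "q j o\<^sub>L q k = 0" if "j \<noteq> k" for j k
  proof -
    have "q j o\<^sub>L q k = (q j o\<^sub>L p k) o\<^sub>L q k" by (simp add: pq blinfun_compose_assoc)
    then show ?thesis using qp0[OF that] by simp
  qed
  obtain P where P: "P \<in> A" "\<And>x. (\<lambda>k. p k x) sums P x"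
    using orthogonal_projections_sum[of A _ p, OF A(1) p orth] by blast
  obtain Q where Q: "Q \<in> M" "projection Q" "\<And>x. (\<lambda>k. q k x) sums Q x"
    using orthogonal_projections_sum[of M _ q, OF M q qq] by blast
  have Qp: "Q o\<^sub>L p k = q k" for k
  proof (rule blinfun_eqI)
    fix x
    have "q j (p k x) = (if j = k then q k x else 0)" for j
      using qp[of k] qp0[of j k] by (metis blinfun_apply_blinfun_compose zero_blinfun.rep_eq)
    then have "(\<lambda>j. q j (p k x)) sums q k x"
      using sums_single[of k "\<lambda>j. q k x"] by simp
    with Q(3)[of "p k x"] show "(Q o\<^sub>L p k) x = q k x" by (simp add: sums_unique2)
  qed
  have QP: "Q o\<^sub>L P = Q"
  proof (rule blinfun_eqI)
    fix x
    have "(\<lambda>k. Q (p k x)) sums Q (P x)"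
      by (rule bounded_linear.sums[OF blinfun.bounded_linear_right P(2)])
    moreover have "Q (p k x) = q k x" for k using Qp by (metis blinfun_apply_blinfun_compose)
    ultimately show "(Q o\<^sub>L P) x = Q x" using Q(3)[of x] by (simp add: sums_unique2)
  qed
  \<comment> \<open>Both operators act on the range of \<open>p k\<close> as \<open>\<alpha> k\<close>, and both vanish on the complement
    of \<open>P\<close>.\<close>
  have "E Q = a"
  proof (rule blinfun_eqI)
    fix x
    have "E Q (p k x) = scaleC (\<alpha> k) (p k x)" for k
    proof -
      have "E Q o\<^sub>L p k = scaleC_op (\<alpha> k) (p k)"
        using E_mult[OF Q(1) p(1)] Qp Eq ap by metis
      then show ?thesis by (metis blinfun_apply_blinfun_compose scaleC_op_apply)
    qed
    then have "(\<lambda>k. scaleC (\<alpha> k) (p k x)) sums E Q (P x)"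
      using bounded_linear.sums[OF blinfun.bounded_linear_right P(2)[of x], of "E Q"] by simp
    moreover have "E Q (P x) = E Q x"
      using E_mult[OF Q(1) P(1)] QP by (metis blinfun_apply_blinfun_compose)
    ultimately show "E Q x = a x" using a[of x] by (simp add: sums_unique2)
  qed
  with Q show ?thesis by blast
qed

end
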